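(* Let $\mathcal{A}$ and $\mathcal{B}$ be infinite sets of non-negative integers and set $\mathcal{S}=\mathcal{A}+\mathcal{B}=\{a+b : a\in\mathcal{A},\ b\in\mathcal{B}\}$. Then there exist uncountably many transcendental functions $f(z)=\sum_{n\in \mathcal{S}}a_nz^n\in \mathbb{Z}\{z\}$ (i.e. all coefficients of indices $n\notin\mathcal{S}$ vanish) such that \[ f^{(m)}\big(\overline{\mathbb{Q}}\cap B(0,1)\big)\subseteq \overline{\mathbb{Q}}\quad \text{for all } m\geq 0. \]
   Context: $\mathbb{Z}\{z\}$ denotes the set of power series $\sum_{n\ge0}a_nz^n$ with integer coefficients $a_n\in\mathbb{Z}$ which converge (hence are analytic) on the open unit disc $B(0,1)=\{z\in\mathbb{C}:|z|<1\}$. A function is transcendental if it is not algebraic over $\mathbb{C}(z)$. $\overline{\mathbb{Q}}$ is the set of algebraic numbers and $f^{(m)}$ is the $m$-th derivative of $f$. *)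

theory Defs
  imports "HOL-Complex_Analysis.Complex_Analysis" "HOL-Computational_Algebra.Computational_Algebra"
    "HOL-Computational_Algebra.Field_as_Ring"
begin

definition integer_series_disc :: "complex fps set" where
  "integer_series_disc =
     {F. (\<forall>n. fps_nth F n \<in> \<int>) \<and> (\<forall>z\<in>ball 0 1. summable (\<lambda>n. fps_nth F n * z ^ n))}"

text \<open>The field of rational functions is the fraction field of the polynomial ring; a rational
  function is evaluated through its reduced fraction, whose denominator vanishes exactly at the
  poles.\<close>

definition ratfun_pole :: "complex poly fract \<Rightarrow> complex \<Rightarrow> bool" where
  "ratfun_pole r z \<longleftrightarrow> poly (snd (quot_of_fract r)) z = 0"

definition ratfun_eval :: "complex poly fract \<Rightarrow> complex \<Rightarrow> complex" where
  "ratfun_eval r z = poly (fst (quot_of_fract r)) z / poly (snd (quot_of_fract r)) z"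

text \<open>An identity between meromorphic functions on a domain holds iff it holds at
  all points that are not poles of the coefficients involved.\<close>

definition algebraic_function_on :: "complex set \<Rightarrow> (complex \<Rightarrow> complex) \<Rightarrow> bool" where
  "algebraic_function_on D f \<longleftrightarrow>
     (\<exists>P :: complex poly fract poly. P \<noteq> 0 \<and>
        (\<forall>z\<in>D. (\<forall>i\<le>degree P. \<not> ratfun_pole (coeff P i) z) \<longrightarrow>
           (\<Sum>i\<le>degree P. ratfun_eval (coeff P i) z * f z ^ i) = 0))"

definition transcendental_function_on :: "complex set \<Rightarrow> (complex \<Rightarrow> complex) \<Rightarrow> bool" where
  "transcendental_function_on D f \<longleftrightarrow> \<not> algebraic_function_on D f"

end

theory Submission
  imports Defs
begin

text \<open>Enumerate the nonzero integer polynomials as \<open>p 0, p 1, \<dots>\<close>. Since \<open>B\<close> is infinite, linear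
  algebra modulo \<open>(\<Prod>i<k. p i ^ k)\<close> yields a nonzero integer polynomial \<open>Q k\<close> divisible by that
  product all of whose exponents lie in \<open>B\<close>. Choose \<open>a k \<in> A\<close> growing very fast and put
  \<open>f = (\<Sum>k. u k * z ^ a k * Q k)\<close> with arbitrary \<open>u k \<in> {1, 2}\<close>. The coefficient of \<open>z ^ n\<close> in \<open>f\<close> is at
  most \<open>n\<close> in absolute value, so \<open>f\<close> converges on the unit disc. At an algebraic point all but
  finitely many blocks vanish to order greater than \<open>m\<close>, so the \<open>m\<close>-th derivative of \<open>f\<close> there is the
  value of an integer polynomial. The gaps force every partial sum \<open>s\<close> of sufficiently many blocks
  to satisfy any polynomial relation \<open>R(z, f) = 0\<close>, which has only finitely many polynomial
  solutions; hence \<open>f\<close> is transcendental. Distinct sequences \<open>u\<close> give distinct \<open>f\<close>.\<close>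

subsection \<open>Integer linear algebra modulo a polynomial\<close>

text \<open>Induction on the number of equations: an unknown with nonzero coefficient in the last
  equation is eliminated from the others. Cross-multiplication replaces division, so the argument
  stays inside an integral domain.\<close>

lemma nontrivial_solution_of_homogeneous_system:
  fixes v :: "'i \<Rightarrow> nat \<Rightarrow> 'a::idom"
  assumes "finite J" and "d < card J"
  shows "\<exists>c. (\<exists>j\<in>J. c j \<noteq> 0) \<and> (\<forall>i<d. (\<Sum>j\<in>J. c j * v j i) = 0)"
  using assms
proof (induction d arbitrary: J v)
  case 0
  then obtain j where "j \<in> J" by fastforce
  then show ?case by (intro exI[of _ "\<lambda>_. 1"]) auto
next
  case (Suc d)
  show ?case
  proof (cases "\<forall>j\<in>J. v j d = 0")
    case True
    obtain c where "\<exists>j\<in>J. c j \<noteq> 0" "\<forall>i<d. (\<Sum>j\<in>J. c j * v j i) = 0"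
      using Suc.IH[of J v] Suc.prems by auto
    with True show ?thesis
      by (intro exI[of _ c]) (auto simp: less_Suc_eq)
  next
    case False
    then obtain p where p: "p \<in> J" "v p d \<noteq> 0" by blast
    define w where "w j i = v p d * v j i - v j d * v p i" for j i
    obtain c where c: "\<exists>j\<in>J-{p}. c j \<noteq> 0"
      and cw: "\<And>i. i < d \<Longrightarrow> (\<Sum>j\<in>J-{p}. c j * w j i) = 0"
      using Suc.IH[of "J - {p}" w] Suc.prems p by (auto simp: less_diff_conv)
    \<comment> \<open>The other unknowns are scaled by the pivot \<open>v p d\<close>;
      \<open>c' p\<close> is then the value forced by equation \<open>d\<close>.\<close>
    define c' where "c' j = (if j = p then - (\<Sum>j\<in>J-{p}. c j * v j d) else v p d * c j)" for j
    have "(\<Sum>j\<in>J. c' j * v j i) = (\<Sum>j\<in>J-{p}. c j * w j i)" for i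
    proof -
      have "(\<Sum>j\<in>J. c' j * v j i) = c' p * v p i + (\<Sum>j\<in>J-{p}. c' j * v j i)"
        using p Suc.prems by (simp add: sum.remove)
      also have "(\<Sum>j\<in>J-{p}. c' j * v j i) = (\<Sum>j\<in>J-{p}. v p d * c j * v j i)"
        by (intro sum.cong) (auto simp: c'_def)
      also have "c' p * v p i + \<dots> = (\<Sum>j\<in>J-{p}. c j * w j i)"
        by (simp add: c'_def w_def sum_distrib_left sum_subtractf algebra_simps)
      finally show ?thesis .
    qed
    moreover have "(\<Sum>j\<in>J-{p}. c j * w j d) = 0"
      by (simp add: w_def mult.commute)
    moreover have "\<exists>j\<in>J. c' j \<noteq> 0"
      using c p by (auto simp: c'_def)
    ultimately show ?thesis
      using cw by (intro exI[of _ c']) (auto simp: less_Suc_eq)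
  qed
qed

text \<open>Remainders modulo \<open>M\<close> have nonzero coefficients only below
  \<open>degree M\<close>, so more than \<open>degree M\<close> of them are linearly dependent.
  Pseudo-division yields remainders of nonzero multiples of the \<open>v j\<close>; these factors
  are absorbed into \<open>c\<close>.\<close>

lemma nontrivial_combination_divisible:
  fixes M :: "'a::idom poly" and v :: "'i \<Rightarrow> 'a poly"
  assumes "M \<noteq> 0" and "finite J" and "degree M < card J"
  shows "\<exists>c. (\<exists>j\<in>J. c j \<noteq> 0) \<and> M dvd (\<Sum>j\<in>J. smult (c j) (v j))"
proof -
  define r where "r j = pseudo_mod (v j) M" for j
  have "\<forall>j. \<exists>a. a \<noteq> 0 \<and> M dvd smult a (v j) - r j"
  proof
    fix j
    obtain a q where "a \<noteq> 0" "smult a (v j) = M * q + r j"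
      using pseudo_mod(1)[OF assms(1)] unfolding r_def by blast
    then show "\<exists>a. a \<noteq> 0 \<and> M dvd smult a (v j) - r j" by auto
  qed
  then obtain a where a: "\<And>j. a j \<noteq> 0" "\<And>j. M dvd smult (a j) (v j) - r j"
    by metis
  obtain c where c: "\<exists>j\<in>J. c j \<noteq> 0"
    and c0: "\<And>i. i < degree M \<Longrightarrow> (\<Sum>j\<in>J. c j * coeff (r j) i) = 0"
    using nontrivial_solution_of_homogeneous_system[OF assms(2,3), of "\<lambda>j. coeff (r j)"] by blast
  have "coeff (r j) i = 0" if "degree M \<le> i" for i j
    using pseudo_mod(2)[OF assms(1), of "v j"] that unfolding r_def[symmetric]
    by (auto intro: coeff_eq_0)
  then have "(\<Sum>j\<in>J. c j * coeff (r j) i) = 0" for i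
    using c0 by (cases "i < degree M") auto
  then have "(\<Sum>j\<in>J. smult (c j) (r j)) = 0"
    by (intro poly_eqI) (simp add: coeff_sum)
  then have "(\<Sum>j\<in>J. smult (c j * a j) (v j)) = (\<Sum>j\<in>J. smult (c j) (smult (a j) (v j) - r j))"
    by (simp add: smult_diff_right sum_subtractf)
  also have "M dvd \<dots>"
    by (intro dvd_sum dvd_smult a(2))
  finally show ?thesis
    using c a(1) by (intro exI[of _ "\<lambda>j. c j * a j"]) auto
qed

section \<open>Integer polynomials at algebraic points\<close>

abbreviation complex_poly :: "int poly \<Rightarrow> complex poly" where
  "complex_poly \<equiv> map_poly of_int"

lemma complex_poly_add: "complex_poly (p + q) = complex_poly p + complex_poly q"
  by (intro poly_eqI) (simp add: coeff_map_poly)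

lemma complex_poly_mult: "complex_poly (p * q) = complex_poly p * complex_poly q"
  by (intro poly_eqI) (simp add: coeff_map_poly coeff_mult)

lemma complex_poly_smult: "complex_poly (smult c p) = smult (of_int c) (complex_poly p)"
  by (intro poly_eqI) (simp add: coeff_map_poly)

lemma complex_poly_power: "complex_poly (p ^ n) = complex_poly p ^ n"
  by (induction n) (simp_all add: complex_poly_mult)

lemma complex_poly_sum: "complex_poly (sum f A) = (\<Sum>x\<in>A. complex_poly (f x))"
  by (intro poly_eqI) (simp add: coeff_map_poly coeff_sum)

lemma complex_poly_dvd: "p dvd q \<Longrightarrow> complex_poly p dvd complex_poly q"
  by (auto simp: complex_poly_mult elim!: dvdE)

lemma higher_pderiv_complex_poly:
  "(pderiv ^^ m) (complex_poly p) = complex_poly ((pderiv ^^ m) p)"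
proof (induction m)
  case (Suc m)
  have "pderiv (complex_poly q) = complex_poly (pderiv q)" for q
    by (intro poly_eqI) (simp add: coeff_map_poly coeff_pderiv)
  with Suc show ?case by simp
qed simp

text \<open>The powers \<open>q ^ 0, ..., q ^ degree p\<close> have a nontrivial integer combination
  divisible by \<open>p\<close>, hence vanishing at \<open>x\<close>. Its coefficients form a
  polynomial that annihilates the value of \<open>q\<close> at \<open>x\<close>.\<close>

lemma algebraic_poly:
  assumes "algebraic x"
  shows "algebraic (poly (complex_poly q) x)"
proof -
  obtain p where p: "p \<noteq> 0" "poly (complex_poly p) x = 0"
    using assms by (rule algebraicE')
  let ?J = "{..degree p}"
  obtain c where c: "\<exists>j\<in>?J. c j \<noteq> 0" and dvd: "p dvd (\<Sum>j\<in>?J. smult (c j) (q ^ j))"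
    using nontrivial_combination_divisible[OF p(1), of ?J "\<lambda>j. q ^ j"] by auto
  define R where "R = (\<Sum>j\<in>?J. monom (c j) j)"
  have coeff_R: "coeff R i = (if i \<in> ?J then c i else 0)" for i
    by (simp add: R_def coeff_sum)
  have "R \<noteq> 0"
    using c coeff_R by (metis coeff_0)
  have "poly (complex_poly R) (poly (complex_poly q) x)
      = poly (complex_poly (\<Sum>j\<in>?J. smult (c j) (q ^ j))) x"
    by (simp add: R_def complex_poly_sum map_poly_monom poly_monom poly_sum complex_poly_smult
        complex_poly_power)
  also have "\<dots> = 0"
    using complex_poly_dvd[OF dvd] p(2) by (auto elim!: dvdE)
  finally show ?thesis
    using \<open>R \<noteq> 0\<close>
    by (intro algebraicI[of "complex_poly R"]) (auto simp: coeff_map_poly map_poly_eq_0_iff)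
qed

text \<open>Each differentiation costs at most one factor \<open>p\<close>, and \<open>m < k\<close>
  leaves at least one.\<close>

lemma higher_pderiv_root_eq_0:
  fixes p q :: "'a::{comm_ring_1,semiring_no_zero_divisors} poly"
  assumes "p ^ k dvd q" and "poly p x = 0" and "m < k"
  shows "poly ((pderiv ^^ m) q) x = 0"
proof -
  have "p ^ (k - m) dvd (pderiv ^^ m) q" if "m \<le> k"
    using that
  proof (induction m)
    case (Suc m)
    define l where "l = k - Suc m"
    have "k - m = Suc l" using Suc.prems by (simp add: l_def)
    with Suc obtain h where "(pderiv ^^ m) q = p ^ Suc l * h"
      by (auto elim!: dvdE)
    then have "(pderiv ^^ Suc m) q = p ^ l * (p * pderiv h + h * smult (of_nat (Suc l)) (pderiv p))"
      by (simp add: pderiv_mult pderiv_power_Suc algebra_simps smult_add_left del: power_Suc)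
        (simp add: algebra_simps)
    then show ?case by (simp add: l_def)
  qed (use assms in simp)
  with assms(3) have "p dvd (pderiv ^^ m) q"
    by (metis dvd_power dvd_trans less_imp_le_nat zero_less_diff)
  with assms(2) show ?thesis by (auto elim!: dvdE)
qed

section \<open>Enumerability of integer polynomials and prescribed exponents\<close>

lemma countable_int_poly: "countable (UNIV :: int poly set)"
  by (rule countableI'[of "\<lambda>p. to_nat (coeffs p)"]) (auto intro!: injI simp: coeffs_eq_iff)

text \<open>Any \<open>degree M + 1\<close> monomials with exponents in \<open>B\<close> have a
  nontrivial combination divisible by \<open>M\<close>.\<close>

lemma exists_poly_supported_on:
  fixes B :: "nat set" and M :: "'a::idom poly"
  assumes "infinite B" and "M \<noteq> 0"
  shows "\<exists>Q. Q \<noteq> 0 \<and> M dvd Q \<and> (\<forall>n. coeff Q n \<noteq> 0 \<longrightarrow> n \<in> B)"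
proof -
  obtain J where J: "J \<subseteq> B" "finite J" "card J = Suc (degree M)"
    using infinite_arbitrarily_large[OF assms(1)] by metis
  obtain c where c: "\<exists>j\<in>J. c j \<noteq> 0" and dvd: "M dvd (\<Sum>j\<in>J. smult (c j) (monom 1 j))"
    using nontrivial_combination_divisible[OF assms(2) J(2), of "monom 1"] J(3) by auto
  define Q where "Q = (\<Sum>j\<in>J. smult (c j) (monom 1 j))"
  have coeff_Q: "coeff Q n = (if n \<in> J then c n else 0)" for n
    using J(2) by (simp add: Q_def coeff_sum smult_monom)
  have "Q \<noteq> 0"
    using c coeff_Q by (metis coeff_0)
  then show ?thesis
    using dvd coeff_Q J(1) by (intro exI[of _ Q]) (auto simp: Q_def)
qed

subsection \<open>Algebraic relations of power series with gaps\<close>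

lemma eval_fps_poly_relation:
  assumes "ereal (norm z) < fps_conv_radius F"
  shows "eval_fps (\<Sum>i\<le>N. fps_of_poly (p i) * F ^ i) z = (\<Sum>i\<le>N. poly (p i) z * eval_fps F z ^ i)"
    and "ereal (norm (z::complex)) < fps_conv_radius (\<Sum>i\<le>N. fps_of_poly (p i) * F ^ i)"
proof -
  have rad: "ereal (norm z) < fps_conv_radius (fps_of_poly (p i) * F ^ i)" for i
    using assms fps_conv_radius_mult[of "fps_of_poly (p i)" "F ^ i"] fps_conv_radius_power[of F i]
    by (metis fps_conv_radius_fps_of_poly less_le_trans min_top(1) top_ereal_def)
  have ev: "eval_fps (fps_of_poly (p i) * F ^ i) z = poly (p i) z * eval_fps F z ^ i" for i
    using assms fps_conv_radius_power[of F i]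
    by (subst eval_fps_mult) (auto simp: eval_fps_power)
  \<comment> \<open>Value and convergence go through one induction, since evaluating a sum termwise
    needs convergence of the part already treated.\<close>
  have "eval_fps (\<Sum>i\<le>N. fps_of_poly (p i) * F ^ i) z = (\<Sum>i\<le>N. poly (p i) z * eval_fps F z ^ i)
      \<and> ereal (norm z) < fps_conv_radius (\<Sum>i\<le>N. fps_of_poly (p i) * F ^ i)"
  proof (induction N)
    case (Suc N)
    then have "ereal (norm z) < fps_conv_radius
        ((\<Sum>i\<le>N. fps_of_poly (p i) * F ^ i) + fps_of_poly (p (Suc N)) * F ^ Suc N)"
      using rad by (intro less_le_trans[OF _ fps_conv_radius_add]) (simp del: power_Suc)
    moreover have "eval_fps ((\<Sum>i\<le>N. fps_of_poly (p i) * F ^ i) + fps_of_poly (p (Suc N)) * F ^ Suc N) z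
      = (\<Sum>i\<le>N. poly (p i) z * eval_fps F z ^ i) + poly (p (Suc N)) z * eval_fps F z ^ Suc N"
      using Suc rad by (subst eval_fps_add) (simp_all add: ev del: power_Suc)
    ultimately show ?case by (simp del: power_Suc)
  qed (use rad[of 0] ev[of 0] in simp)
  then show "eval_fps (\<Sum>i\<le>N. fps_of_poly (p i) * F ^ i) z = (\<Sum>i\<le>N. poly (p i) z * eval_fps F z ^ i)"
    and "ereal (norm z) < fps_conv_radius (\<Sum>i\<le>N. fps_of_poly (p i) * F ^ i)"
    by blast+
qed

text \<open>Clearing denominators gives a relation with polynomial coefficients on the whole disc; a
  convergent power series whose values vanish near 0 is the zero series.\<close>

lemma algebraic_function_imp_fps_relation:
  assumes "algebraic_function_on (ball 0 1) (eval_fps F)" and rad: "fps_conv_radius F \<ge> 1"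
  shows "\<exists>R. R \<noteq> 0 \<and> (\<Sum>i\<le>degree R. fps_of_poly (coeff R i) * F ^ i) = 0"
proof -
  obtain P :: "complex poly fract poly" where "P \<noteq> 0"
    and P: "\<And>z. z \<in> ball 0 1 \<Longrightarrow> (\<And>i. i \<le> degree P \<Longrightarrow> \<not> ratfun_pole (coeff P i) z) \<Longrightarrow>
      (\<Sum>i\<le>degree P. ratfun_eval (coeff P i) z * eval_fps F z ^ i) = 0"
    using assms(1) unfolding algebraic_function_on_def by blast
  define N where "N = degree P"
  define num where "num i = fst (quot_of_fract (coeff P i))" for i
  define den where "den i = snd (quot_of_fract (coeff P i))" for i
  define D where "D = (\<Prod>i\<le>N. den i)"
  \<comment> \<open>This is \<open>D ^ 2\<close> times the \<open>i\<close>-th coefficient of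
    \<open>P\<close>, with one denominator cancelled.\<close>
  define p where "p i = D * num i * (\<Prod>j\<in>{..N}-{i}. den j)" for i
  have den_nz: "den i \<noteq> 0" for i by (simp add: den_def)
  have "num N \<noteq> 0"
    using \<open>P \<noteq> 0\<close> by (simp add: num_def N_def)
  then have "p N \<noteq> 0"
    by (simp add: p_def D_def den_nz)
  \<comment> \<open>The additional factor \<open>D\<close> makes the relation hold at the poles as well.\<close>
  have rel: "(\<Sum>i\<le>N. poly (p i) z * eval_fps F z ^ i) = 0" if z: "z \<in> ball 0 1" for z
  proof (cases "poly D z = 0")
    case False
    then have nz: "poly (den i) z \<noteq> 0" if "i \<le> N" for i
      using that by (auto simp: D_def poly_prod)
    have "(\<Sum>i\<le>N. poly (p i) z * eval_fps F z ^ i)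
        = (\<Sum>i\<le>N. poly D z * poly D z * (ratfun_eval (coeff P i) z * eval_fps F z ^ i))"
    proof (intro sum.cong refl)
      fix i assume i: "i \<in> {..N}"
      have "D = den i * (\<Prod>j\<in>{..N}-{i}. den j)"
        using i by (simp add: D_def prod.remove)
      then have "poly (p i) z = poly D z * poly D z * ratfun_eval (coeff P i) z"
        using nz i by (simp add: p_def ratfun_eval_def num_def [symmetric] den_def [symmetric])
      then show "poly (p i) z * eval_fps F z ^ i
          = poly D z * poly D z * (ratfun_eval (coeff P i) z * eval_fps F z ^ i)"
        by simp
    qed
    also have "\<dots> = poly D z * poly D z * (\<Sum>i\<le>N. ratfun_eval (coeff P i) z * eval_fps F z ^ i)"
      by (simp add: sum_distrib_left)
    also have "\<dots> = 0"
      using P[OF z] nz by (simp add: ratfun_pole_def N_def den_def)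
    finally show ?thesis .
  qed (simp add: p_def)
  define R where "R = (\<Sum>i\<le>N. monom (p i) i)"
  have coeff_R: "coeff R i = (if i \<le> N then p i else 0)" for i
    by (simp add: R_def coeff_sum)
  have deg: "degree R = N"
    using \<open>p N \<noteq> 0\<close> by (intro antisym degree_le le_degree) (auto simp: coeff_R)
  let ?G = "\<Sum>i\<le>N. fps_of_poly (p i) * F ^ i"
  have small: "ereal (norm z) < fps_conv_radius F" if "z \<in> ball 0 1" for z :: complex
    using that rad by (intro less_le_trans[OF _ rad]) (simp add: one_ereal_def)
  have "?G = 0"
  proof (rule eval_fps_eqD)
    show "fps_conv_radius ?G > 0"
      using eval_fps_poly_relation(2)[OF small[of 0], of p N] by (simp add: zero_ereal_def)
    have "eventually (\<lambda>z::complex. z \<in> ball 0 1) (nhds 0)"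
      by (intro eventually_nhds_in_open) auto
    then show "eventually (\<lambda>z. eval_fps ?G z = eval_fps 0 z) (nhds 0)"
      by eventually_elim (simp add: eval_fps_poly_relation(1) small rel)
  qed simp
  then have "(\<Sum>i\<le>degree R. fps_of_poly (coeff R i) * F ^ i) = 0"
    by (simp add: deg coeff_R)
  moreover have "R \<noteq> 0"
    using \<open>p N \<noteq> 0\<close> coeff_R[of N] by auto
  ultimately show ?thesis by blast
qed

lemma fps_mult_nth_cong:
  assumes "\<And>n. n < a \<Longrightarrow> fps_nth F n = fps_nth F' n" and "\<And>n. n < a \<Longrightarrow> fps_nth G n = fps_nth G' n"
    and "n < a"
  shows "fps_nth (F * G) n = fps_nth (F' * G') n"
  using assms unfolding fps_mult_nth by (intro sum.cong) auto

lemma fps_power_nth_cong: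
  assumes "\<And>n. n < a \<Longrightarrow> fps_nth F n = fps_nth G n" and "n < a"
  shows "fps_nth (F ^ i) n = fps_nth (G ^ i) n"
  using assms(2)
proof (induction i arbitrary: n)
  case (Suc i)
  then show ?case
    using fps_mult_nth_cong[of a F G "F ^ i" "G ^ i" n] assms(1) by simp
qed simp

text \<open>If \<open>R(z, F) = 0\<close>, then \<open>R(z, s k)\<close> vanishes to an order exceeding its degree, so the
  infinitely many polynomials \<open>s k\<close> would all be roots of \<open>R\<close>.\<close>

lemma transcendental_function_on_if_gaps:
  fixes s :: "nat \<Rightarrow> complex poly" and a :: "nat \<Rightarrow> nat"
  assumes rad: "fps_conv_radius F \<ge> 1" and "inj s"
    and agree: "\<And>k n. n < a k \<Longrightarrow> fps_nth F n = coeff (s k) n"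
    and gap: "\<And>N. \<forall>\<^sub>F k in sequentially. N * (degree (s k) + 1) \<le> a k"
  shows "transcendental_function_on (ball 0 1) (eval_fps F)"
  unfolding transcendental_function_on_def
proof
  assume "algebraic_function_on (ball 0 1) (eval_fps F)"
  then obtain R where "R \<noteq> 0" and R: "(\<Sum>i\<le>degree R. fps_of_poly (coeff R i) * F ^ i) = 0"
    using algebraic_function_imp_fps_relation rad by blast
  define d where "d = (\<Sum>i\<le>degree R. degree (coeff R i))"
  \<comment> \<open>Below \<open>a k\<close> the coefficients are those of
    \<open>R(z, F) = 0\<close>. From \<open>a k\<close> on they vanish, because the chosen factor
    pushes \<open>a k\<close> beyond the degree bound
    \<open>d + degree R * degree (s k)\<close>.\<close>
  have "poly R (s k) = 0" if k: "(d + degree R + 1) * (degree (s k) + 1) \<le> a k" for k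
  proof (rule poly_eqI)
    fix n
    show "coeff (poly R (s k)) n = coeff 0 n"
    proof (cases "n < a k")
      case True
      have "fps_nth (fps_of_poly (coeff R i) * fps_of_poly (s k) ^ i) n
          = fps_nth (fps_of_poly (coeff R i) * F ^ i) n" for i
        using fps_mult_nth_cong[OF refl, of "a k" _ "F ^ i" n] agree True
        by (metis fps_of_poly_nth fps_power_nth_cong)
      then have "fps_nth (fps_of_poly (poly R (s k))) n
          = fps_nth (\<Sum>i\<le>degree R. fps_of_poly (coeff R i) * F ^ i) n"
        by (simp add: poly_altdef fps_of_poly_sum fps_of_poly_mult fps_of_poly_power fps_sum_nth)
      with R show ?thesis by simp
    next
      case False
      have "degree (coeff R i * s k ^ i) \<le> d + degree R * degree (s k)" if "i \<le> degree R" for i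
      proof -
        have "degree (coeff R i) \<le> d"
          unfolding d_def using that by (intro member_le_sum) auto
        moreover have "degree (s k ^ i) \<le> degree R * degree (s k)"
          using degree_power_le[of "s k" i] that
          by (metis dual_order.trans mult.commute mult_le_mono1)
        ultimately show ?thesis
          using degree_mult_le[of "coeff R i" "s k ^ i"] by linarith
      qed
      then have "degree (poly R (s k)) \<le> d + degree R * degree (s k)"
        unfolding poly_altdef by (intro degree_sum_le) auto
      also have "\<dots> < (d + degree R + 1) * (degree (s k) + 1)"
        by (simp add: algebra_simps)
      finally show ?thesis
        using k False by (simp add: coeff_eq_0)
    qed
  qed
  then have "\<forall>\<^sub>F k in sequentially. poly R (s k) = 0"
    using gap[of "d + degree R + 1"] by (auto elim: eventually_mono)
  then obtain K where K: "\<And>k. k \<ge> K \<Longrightarrow> poly R (s k) = 0"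
    by (auto simp: eventually_sequentially)
  have "infinite (s ` {K..})"
    using \<open>inj s\<close> by (simp add: finite_image_iff inj_on_subset infinite_Ici)
  moreover have "s ` {K..} \<subseteq> {q. poly R q = 0}"
    using K by auto
  ultimately show False
    using poly_roots_finite[OF \<open>R \<noteq> 0\<close>] finite_subset by blast
qed

subsection \<open>Derivatives of power series as stationary values\<close>

lemma higher_fps_deriv_nth:
  "fps_nth ((fps_deriv ^^ m) F) n = pochhammer (of_nat (Suc n)) m * fps_nth F (n + m)"
  for F :: "'a::comm_ring_1 fps"
  by (induction m arbitrary: n) (simp_all add: pochhammer_rec algebra_simps)

lemma fps_conv_radius_higher_deriv:
  fixes F :: "complex fps"
  shows "fps_conv_radius F \<le> fps_conv_radius ((fps_deriv ^^ m) F)"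
  by (induction m) (auto intro: order_trans[OF _ fps_conv_radius_deriv])

lemma higher_deriv_eval_fps:
  assumes "ereal (norm z) < fps_conv_radius F"
  shows "(deriv ^^ m) (eval_fps F) z = eval_fps ((fps_deriv ^^ m) F) (z::complex)"
  using assms
proof (induction m arbitrary: z)
  case (Suc m)
  have "eventually (\<lambda>w. w \<in> eball 0 (fps_conv_radius F)) (nhds z)"
    using Suc.prems by (intro eventually_nhds_in_open) (auto simp: in_eball_iff)
  then have "eventually (\<lambda>w. (deriv ^^ m) (eval_fps F) w = eval_fps ((fps_deriv ^^ m) F) w) (nhds z)"
    by eventually_elim (simp add: Suc.IH in_eball_iff)
  then have "deriv ((deriv ^^ m) (eval_fps F)) z = deriv (eval_fps ((fps_deriv ^^ m) F)) z"
    by (intro deriv_cong_ev refl)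
  also have "\<dots> = eval_fps (fps_deriv ((fps_deriv ^^ m) F)) z"
    using Suc.prems fps_conv_radius_higher_deriv[of F m] by (subst eval_fps_deriv) auto
  finally show ?case by simp
qed simp

lemma higher_pderiv_fps_of_poly: "fps_of_poly ((pderiv ^^ m) p) = (fps_deriv ^^ m) (fps_of_poly p)"
  by (induction m) (simp_all add: fps_of_poly_pderiv)

lemma poly_eq_sum_lessThan:
  fixes p :: "'a::{comm_semiring_0,semiring_1} poly"
  assumes "\<And>n. n \<ge> N \<Longrightarrow> coeff p n = 0"
  shows "poly p z = (\<Sum>n<N. coeff p n * z ^ n)"
proof -
  have "poly p z = (\<Sum>n\<in>{..degree p} \<union> {..<N}. coeff p n * z ^ n)"
    unfolding poly_altdef by (intro sum.mono_neutral_left) (auto simp: coeff_eq_0)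
  also have "\<dots> = (\<Sum>n<N. coeff p n * z ^ n)"
    using assms by (intro sum.mono_neutral_right) (auto simp: not_less)
  finally show ?thesis .
qed

text \<open>Differentiation lowers exponents by \<open>m\<close>, so the series of the
  \<open>m\<close>-th derivative cut off at \<open>a k - m\<close> is
  \<open>(pderiv ^^ m) (s k)\<close>. Along this subsequence the partial sums at \<open>z\<close>
  are eventually the constant \<open>c\<close>.\<close>

lemma higher_deriv_eval_fps_eq_stationary_value:
  fixes s :: "nat \<Rightarrow> complex poly" and a :: "nat \<Rightarrow> nat"
  assumes rad: "ereal (norm z) < fps_conv_radius F" and "strict_mono a"
    and agree: "\<And>k n. n < a k \<Longrightarrow> fps_nth F n = coeff (s k) n"
    and vanish: "\<And>k n. n \<ge> a k \<Longrightarrow> coeff (s k) n = 0"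
    and stationary: "\<And>k. k \<ge> K \<Longrightarrow> poly ((pderiv ^^ m) (s k)) z = c"
  shows "(deriv ^^ m) (eval_fps F) z = c"
proof -
  let ?F = "(fps_deriv ^^ m) F"
  have coeff: "coeff ((pderiv ^^ m) p) n = pochhammer (of_nat (Suc n)) m * coeff p (n + m)"
    for p :: "complex poly" and n
    using higher_fps_deriv_nth[of m "fps_of_poly p" n]
    by (simp flip: higher_pderiv_fps_of_poly)
  have sum_eq: "(\<Sum>n<a k - m. fps_nth ?F n * z ^ n) = c" if "k \<ge> K" for k
  proof -
    have "(\<Sum>n<a k - m. fps_nth ?F n * z ^ n) = (\<Sum>n<a k - m. coeff ((pderiv ^^ m) (s k)) n * z ^ n)"
      by (intro sum.cong) (auto simp: higher_fps_deriv_nth coeff agree less_diff_conv)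
    also have "\<dots> = poly ((pderiv ^^ m) (s k)) z"
      by (intro poly_eq_sum_lessThan[symmetric]) (simp add: coeff vanish le_diff_conv)
    finally show ?thesis using stationary that by simp
  qed
  have "(\<lambda>n. fps_nth ?F n * z ^ n) sums eval_fps ?F z"
    using rad fps_conv_radius_higher_deriv[of F m] by (intro sums_eval_fps) auto
  moreover have "filterlim (\<lambda>k. a k - m) at_top at_top"
    using \<open>strict_mono a\<close>
    by (intro filterlim_compose[OF filterlim_minus_const_nat_at_top] filterlim_subseq)
  ultimately have "(\<lambda>k. \<Sum>n<a k - m. fps_nth ?F n * z ^ n) \<longlonglongrightarrow> eval_fps ?F z"
    unfolding sums_def by (rule filterlim_compose)
  moreover have "(\<lambda>k. \<Sum>n<a k - m. fps_nth ?F n * z ^ n) \<longlonglongrightarrow> c"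
    using sum_eq by (intro tendsto_eventually) (auto simp: eventually_sequentially)
  ultimately show ?thesis
    using LIMSEQ_unique rad by (simp add: higher_deriv_eval_fps)
qed

subsection \<open>Series of widely spaced integer blocks\<close>

text \<open>The factor \<open>Suc k\<close> in \<open>gap\<close> lets the start of a block outgrow
  every fixed multiple of the degree of the preceding sum, as transcendence requires. The factor 2
  in \<open>coeff_bound\<close> leaves room for multipliers of absolute value at most 2.\<close>

locale gap_series =
  fixes Q :: "nat \<Rightarrow> int poly" and a :: "nat \<Rightarrow> nat"
  assumes nonzero: "Q k \<noteq> 0"
    and gap: "Suc k * (a k + degree (Q k) + 1) \<le> a (Suc k)"
    and coeff_bound: "2 * \<bar>coeff (Q k) n\<bar> \<le> int (a k)"
begin

definition partial :: "(nat \<Rightarrow> int) \<Rightarrow> nat \<Rightarrow> int poly" where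
  "partial u K = (\<Sum>k<K. smult (u k) (monom 1 (a k) * Q k))"

text \<open>The blocks \<open>z ^ a k * Q k\<close> occupy disjoint ranges of exponents and \<open>n < a (Suc n)\<close>, so the
  coefficient of \<open>z ^ n\<close> has settled after \<open>Suc n\<close> blocks.\<close>

definition series :: "(nat \<Rightarrow> int) \<Rightarrow> complex fps" where
  "series u = Abs_fps (\<lambda>n. of_int (coeff (partial u (Suc n)) n))"

lemma block_end_less: "a k + degree (Q k) < a (Suc k)"
  using gap[of k] by (simp add: algebra_simps)

lemma strict_mono_a: "strict_mono a"
  using block_end_less by (metis add_lessD1 strict_mono_Suc_iff)

lemma partial_Suc: "partial u (Suc K) = partial u K + smult (u K) (monom 1 (a K) * Q K)"
  by (simp add: partial_def)

lemma coeff_block: "coeff (monom 1 (a k) * Q k) n = (if n < a k then 0 else coeff (Q k) (n - a k))"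
  by (simp add: coeff_monom_mult)

lemma coeff_partial_eq_0: "a K \<le> n \<Longrightarrow> coeff (partial u K) n = 0"
proof (induction K)
  case (Suc K)
  then show ?case
    using block_end_less[of K] by (simp add: partial_Suc coeff_block coeff_eq_0)
qed (simp add: partial_def)

lemma coeff_partial_stable:
  assumes "K \<le> L" and "n < a K"
  shows "coeff (partial u L) n = coeff (partial u K) n"
  using assms(1)
proof (induction L rule: dec_induct)
  case (step L)
  have "n < a L"
    using assms(2) step.hyps strict_mono_less_eq[OF strict_mono_a] by (meson less_le_trans)
  with step show ?case by (simp add: partial_Suc coeff_block)
qed simp

lemma series_nth:
  assumes "n < a K"
  shows "fps_nth (series u) n = of_int (coeff (partial u K) n)"
proof -
  have "n < a (Suc n)"
    using strict_mono_imp_increasing[OF strict_mono_a, of "Suc n"] by simp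
  with assms show ?thesis
    using coeff_partial_stable[of K "Suc n" n u] coeff_partial_stable[of "Suc n" K n u]
    by (cases "K \<le> Suc n") (simp_all add: series_def)
qed

lemma coeff_partial_last: "coeff (partial u (Suc k)) (a k + degree (Q k)) = u k * lead_coeff (Q k)"
  by (simp add: partial_Suc coeff_block coeff_partial_eq_0)

lemma series_nth_last: "fps_nth (series u) (a k + degree (Q k)) = of_int (u k * lead_coeff (Q k))"
  using series_nth[OF block_end_less, of u k] by (simp add: coeff_partial_last)

text \<open>The last coefficient of block \<open>k\<close> is \<open>u k\<close> times a nonzero
  leading coefficient, so the series determines \<open>u k\<close>.\<close>

lemma inj_series: "inj series"
proof
  fix u v assume "series u = series v"
  then have "(of_int (u k * lead_coeff (Q k)) :: complex) = of_int (v k * lead_coeff (Q k))" for k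
    by (metis series_nth_last)
  then show "u = v"
    by (simp add: nonzero fun_eq_iff del: of_int_mult)
qed

text \<open>For \<open>n \<ge> a K\<close>, adding block \<open>K\<close> makes it the only
  contributor at exponent \<open>n\<close>, with a term of size at most \<open>a K \<le> n\<close>.
  Such linear growth suffices for convergence on the unit disc.\<close>

lemma abs_coeff_partial_le:
  assumes "\<And>k. \<bar>u k\<bar> \<le> 2"
  shows "\<bar>coeff (partial u K) n\<bar> \<le> int n"
proof (induction K)
  case (Suc K)
  show ?case
  proof (cases "n < a K")
    case False
    have "\<bar>u K * coeff (Q K) (n - a K)\<bar> \<le> 2 * \<bar>coeff (Q K) (n - a K)\<bar>"
      using assms[of K] by (simp add: abs_mult mult_right_mono)
    also have "\<dots> \<le> int n"
      using coeff_bound[of K "n - a K"] False by linarith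
    finally show ?thesis
      using False by (simp add: partial_Suc coeff_block coeff_partial_eq_0)
  qed (use Suc in \<open>simp add: partial_Suc coeff_block\<close>)
qed (simp add: partial_def)

lemma summable_series:
  assumes "\<And>k. \<bar>u k\<bar> \<le> 2" and "norm (z::complex) < 1"
  shows "summable (\<lambda>n. fps_nth (series u) n * z ^ n)"
proof (rule summable_comparison_test)
  show "summable (\<lambda>n. of_nat (Suc n) * norm z ^ n)"
    using geometric_deriv_sums[of "norm z"] assms(2) by (auto simp: sums_iff)
  have "norm (fps_nth (series u) n) \<le> of_nat (Suc n)" for n
  proof -
    have "real_of_int \<bar>coeff (partial u (Suc n)) n\<bar> \<le> real_of_int (int n)"
      using abs_coeff_partial_le[OF assms(1)] by (simp only: of_int_le_iff)
    then show ?thesis by (simp add: series_def)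
  qed
  then show "\<exists>N. \<forall>n\<ge>N. norm (fps_nth (series u) n * z ^ n) \<le> of_nat (Suc n) * norm z ^ n"
    by (auto simp: norm_mult norm_power intro!: mult_right_mono simp del: of_nat_Suc)
qed

lemma fps_conv_radius_series:
  assumes "\<And>k. \<bar>u k\<bar> \<le> 2"
  shows "fps_conv_radius (series u) \<ge> 1"
  unfolding fps_conv_radius_def
  by (rule conv_radius_geI_ex') (auto simp: one_ereal_def intro!: summable_series assms)

lemma series_in_integer_series_disc:
  assumes "\<And>k. \<bar>u k\<bar> \<le> 2"
  shows "series u \<in> integer_series_disc"
  using summable_series[OF assms] by (simp add: integer_series_disc_def) (simp add: series_def)

lemma series_nth_nonzero_imp:
  assumes "fps_nth (series u) n \<noteq> 0"
  shows "\<exists>k b. n = a k + b \<and> coeff (Q k) b \<noteq> 0"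
proof -
  have "(\<Sum>k<Suc n. u k * coeff (monom 1 (a k) * Q k) n) \<noteq> 0"
    using assms by (simp add: series_def partial_def coeff_sum del: sum.lessThan_Suc of_int_mult of_int_sum
        flip: of_int_sum of_int_mult)
  then obtain k where "coeff (monom 1 (a k) * Q k) n \<noteq> 0"
    by (metis (no_types, lifting) mult_zero_right sum.neutral)
  then have "n = a k + (n - a k)" "coeff (Q k) (n - a k) \<noteq> 0"
    by (auto simp: coeff_block split: if_splits)
  then show ?thesis by blast
qed

text \<open>The gap criterion is applied to the sums through block \<open>k\<close>, paired with the
  start \<open>a (Suc k)\<close> of the next block.\<close>

lemma transcendental_series:
  assumes "\<And>k. \<bar>u k\<bar> \<le> 2" and "\<And>k. u k \<noteq> 0"
  shows "transcendental_function_on (ball 0 1) (eval_fps (series u))"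
proof (rule transcendental_function_on_if_gaps)
  let ?s = "\<lambda>k. complex_poly (partial u (Suc k))"
  show "fps_conv_radius (series u) \<ge> 1"
    using assms(1) by (rule fps_conv_radius_series)
  have "?s k \<noteq> ?s l" if "k < l" for k l
  proof -
    \<comment> \<open>At the last exponent of block \<open>l\<close> the longer sum is nonzero,
      while the shorter one has already ended.\<close>
    let ?n = "a l + degree (Q l)"
    have "a (Suc k) \<le> ?n"
      using that strict_mono_less_eq[OF strict_mono_a, of "Suc k" l] by simp
    then have "coeff (?s k) ?n = 0"
      by (simp add: coeff_map_poly coeff_partial_eq_0)
    moreover have "coeff (?s l) ?n \<noteq> 0"
      by (simp add: coeff_map_poly coeff_partial_last assms(2) nonzero)
    ultimately show ?thesis by metis
  qed
  then show "inj ?s"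
    by (rule linorder_injI)
  show "fps_nth (series u) n = coeff (?s k) n" if "n < a (Suc k)" for k n
    using series_nth[OF that] by (simp add: coeff_map_poly)
  have "degree (?s k) \<le> a k + degree (Q k)" for k
    by (intro degree_le)
      (auto simp: coeff_map_poly partial_Suc coeff_block coeff_partial_eq_0 coeff_eq_0)
  then have "N * (degree (?s k) + 1) \<le> a (Suc k)" if "N \<le> k" for N k
    using that by (intro order_trans[OF mult_le_mono gap]) auto
  then show "\<forall>\<^sub>F k in sequentially. N * (degree (?s k) + 1) \<le> a (Suc k)" for N
    by (auto simp: eventually_sequentially)
qed

text \<open>From some index on, the blocks are divisible by \<open>p ^ Suc m\<close> and drop out of
  the \<open>m\<close>-th derivative at \<open>z\<close>. What remains is the value of an integer
  polynomial at an algebraic number.\<close>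

lemma algebraic_higher_deriv_series:
  assumes u: "\<And>k. \<bar>u k\<bar> \<le> 2"
    and dvd: "\<And>m. \<exists>K. \<forall>k\<ge>K. p ^ m dvd Q k"
    and root: "poly (complex_poly p) z = 0"
    and "algebraic z" and "norm z < 1"
  shows "algebraic ((deriv ^^ m) (eval_fps (series u)) z)"
proof -
  obtain K where K: "\<And>k. k \<ge> K \<Longrightarrow> p ^ Suc m dvd Q k"
    using dvd by blast
  let ?v = "\<lambda>k. poly ((pderiv ^^ m) (complex_poly (partial u k))) z"
  have "?v k = ?v K" if "k \<ge> K" for k
    using that
  proof (induction k rule: dec_induct)
    case (step k)
    let ?b = "complex_poly (smult (u k) (monom 1 (a k) * Q k))"
    have "complex_poly p ^ Suc m dvd ?b"
      using complex_poly_dvd[OF K[OF step.hyps(1)]]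
      by (simp add: complex_poly_smult complex_poly_mult complex_poly_power dvd_smult
          del: power_Suc)
    then have "poly ((pderiv ^^ m) ?b) z = 0"
      by (rule higher_pderiv_root_eq_0) (use root in auto)
    with step show ?case
      by (simp add: partial_Suc complex_poly_add higher_pderiv_add)
  qed simp
  moreover have "ereal (norm z) < fps_conv_radius (series u)"
    using \<open>norm z < 1\<close>
    by (intro less_le_trans[OF _ fps_conv_radius_series[OF u]]) (simp add: one_ereal_def)
  ultimately have "(deriv ^^ m) (eval_fps (series u)) z = ?v K"
    using strict_mono_a
    by (intro higher_deriv_eval_fps_eq_stationary_value[where K = K and a = a
          and s = "\<lambda>k. complex_poly (partial u k)"])
      (assumption | simp add: coeff_map_poly series_nth coeff_partial_eq_0)+
  then show ?thesis
    using algebraic_poly[OF \<open>algebraic z\<close>] by (simp add: higher_pderiv_complex_poly)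
qed

end

section \<open>Choice of the shifts and the uncountable family\<close>

lemma exists_gap_sequence:
  fixes A :: "nat set" and Q :: "nat \<Rightarrow> int poly"
  assumes "infinite A" and "\<And>k. Q k \<noteq> 0"
  shows "\<exists>a. (\<forall>k. a k \<in> A) \<and> gap_series Q a"
proof -
  \<comment> \<open>All demands on the next shift are lower bounds, and the infinite set
    \<open>A\<close> is unbounded.\<close>
  have large: "\<exists>x. (x \<in> A \<and> (\<forall>n. 2 * \<bar>coeff (Q k) n\<bar> \<le> int x)) \<and> y \<le> x" for k y
  proof -
    define C where "C = (\<Sum>i\<le>degree (Q k). 2 * \<bar>coeff (Q k) i\<bar>)"
    obtain x where x: "x \<in> A" "max (nat C) y \<le> x"
      using \<open>infinite A\<close> unfolding infinite_nat_iff_unbounded_le by blast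
    have "2 * \<bar>coeff (Q k) n\<bar> \<le> C" for n
      unfolding C_def
      by (cases "n \<le> degree (Q k)")
        (auto intro: member_le_sum[of _ _ "\<lambda>i. 2 * \<bar>coeff (Q k) i\<bar>"] simp: coeff_eq_0 sum_nonneg)
    moreover have "C \<le> int x" using x(2) by linarith
    ultimately show ?thesis
      using x by (meson max.bounded_iff order_trans)
  qed
  have "\<exists>a. \<forall>k. (a k \<in> A \<and> (\<forall>n. 2 * \<bar>coeff (Q k) n\<bar> \<le> int (a k))) \<and>
      Suc k * (a k + degree (Q k) + 1) \<le> a (Suc k)"
    using large by (intro dependent_nat_choice) blast+
  then show ?thesis
    unfolding gap_series_def using assms(2) by blast
qed

theorem theorem1p1:
  fixes A B S :: "nat set"
  assumes "infinite A" and "infinite B"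
    and "S = {a + b | a b. a \<in> A \<and> b \<in> B}"
  shows "uncountable {F \<in> integer_series_disc.
           (\<forall>n. n \<notin> S \<longrightarrow> fps_nth F n = 0) \<and>
           transcendental_function_on (ball 0 1) (eval_fps F) \<and>
           (\<forall>m. (deriv ^^ m) (eval_fps F) ` ({z. algebraic z} \<inter> ball 0 1) \<subseteq> {w. algebraic w})}"
    (is "uncountable ?T")
proof -
  \<comment> \<open>Every nonzero integer polynomial occurs as some \<open>p i\<close>, so each
    algebraic number is a root of one of them.\<close>
  define p where "p = from_nat_into (UNIV - {0 :: int poly})"
  have "countable (UNIV - {0 :: int poly})"
    using countable_int_poly by (rule countable_subset[rotated]) auto
  moreover have "UNIV - {0 :: int poly} \<noteq> {}"
    using one_neq_zero by blast
  ultimately have range_p: "range p = UNIV - {0}"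
    unfolding p_def by (rule range_from_nat_into[rotated])
  then have "(\<Prod>i<k. p i ^ k) \<noteq> 0" for k
    by (auto simp: set_eq_iff)
  then have "\<forall>k. \<exists>Q. Q \<noteq> 0 \<and> (\<Prod>i<k. p i ^ k) dvd Q \<and> (\<forall>n. coeff Q n \<noteq> 0 \<longrightarrow> n \<in> B)"
    using exists_poly_supported_on[OF \<open>infinite B\<close>] by blast
  then obtain Q where Q: "\<And>k. Q k \<noteq> 0" and dvd_Q: "\<And>k. (\<Prod>i<k. p i ^ k) dvd Q k"
    and supp: "\<And>k n. coeff (Q k) n \<noteq> 0 \<Longrightarrow> n \<in> B"
    by metis
  obtain a where a: "\<And>k. a k \<in> A" and "gap_series Q a"
    using exists_gap_sequence[where Q = Q, OF \<open>infinite A\<close> Q] by blast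
  interpret gap_series Q a by fact
  \<comment> \<open>Once \<open>k > i\<close> and \<open>k \<ge> m\<close>, the power
    \<open>p i ^ k\<close> is among the factors of the product dividing \<open>Q k\<close>.\<close>
  have dvd: "\<exists>K. \<forall>k\<ge>K. p i ^ m dvd Q k" for i m
  proof (intro exI allI impI)
    fix k assume "max (Suc i) m \<le> k"
    then have "p i ^ m dvd p i ^ k" "p i ^ k dvd (\<Prod>i<k. p i ^ k)"
      by (auto intro: le_imp_power_dvd dvd_prodI)
    with dvd_Q show "p i ^ m dvd Q k"
      by (meson dvd_trans)
  qed
  \<comment> \<open>Subsets \<open>X\<close> of the naturals encode uncountably many sequences. Both
    values are nonzero, so \<open>transcendental_series\<close> applies to each.\<close>
  define u where "u X k = (if k \<in> X then 2 else 1 :: int)" for X and k :: nat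
  have u: "\<bar>u X k\<bar> \<le> 2" "u X k \<noteq> 0" for X k
    by (auto simp: u_def)
  have "series (u X) \<in> ?T" for X
  proof -
    have "fps_nth (series (u X)) n = 0" if "n \<notin> S" for n
      using series_nth_nonzero_imp[of "u X" n] that assms(3) a supp by blast
    moreover have "algebraic ((deriv ^^ m) (eval_fps (series (u X))) z)"
      if z: "algebraic z" "norm z < 1" for m z
    proof -
      obtain q where "q \<noteq> 0" and root: "poly (complex_poly q) z = 0"
        using z(1) by (rule algebraicE')
      then obtain i where "q = p i"
        using range_p by blast
      with root z show ?thesis
        using algebraic_higher_deriv_series[of "u X", OF u(1) dvd] by blast
    qed
    ultimately show ?thesis
      using series_in_integer_series_disc[OF u(1)] transcendental_series[OF u] by auto
  qed
  then have "range (\<lambda>X. series (u X)) \<subseteq> ?T" by blast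
  moreover have "inj u"
    by (rule injI) (auto simp: u_def fun_eq_iff split: if_splits)
  then have "inj (\<lambda>X. series (u X))"
    using inj_compose[OF inj_series] by (simp add: o_def)
  moreover have "uncountable (UNIV :: nat set set)"
    by (metis Cantors_theorem Pow_UNIV UNIV_not_empty range_from_nat_into)
  ultimately show ?thesis
    by (meson countable_image_inj_on countable_subset)
qed

end
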